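(* Let $r\ge 2$. For $1\le j\le r$ let $G_j=(V_j,E_j)$ be a connected graph on $|V_j|\ge 2$ vertices ($|V_j|=\infty$ may happen) with a distinguished vertex $o_j\in V_j$. Assume that every $G_j$ is of QE class with QE constant $Q_j=\mathrm{QEC}(G_j)<0$. Then $$\mathrm{QEC}(G_1\star\dots\star G_r)\le\left(\frac1{Q_1}+\dots+\frac1{Q_r}\right)^{-1}<0.$$
   Context: Graphs are undirected and may be finite or infinite. For a connected graph $G=(V,E)$, $d(x,y)$ denotes the graph distance (length of a shortest path) and $D=[d(x,y)]_{x,y\in V}$ the distance matrix. $C_0(V)$ is the space of real-valued functions on $V$ with finite support, $\langle f,g\rangle=\sum_{x\in V}f(x)g(x)$, and $\langle \mathbf 1,f\rangle=\sum_{x\in V}f(x)$. The QE constant is $\mathrm{QEC}(G)=\sup\{\langle f,Df\rangle : f\in C_0(V),\ \langle f,f\rangle=1,\ \langle\mathbf 1,f\rangle=0\}$. $G$ is of QE class if there is a map $\varphi$ from $V$ into a real Hilbert space with $\|\varphi(x)-\varphi(y)\|^2=d(x,y)$ for all $x,y\in V$ (equivalently, $\mathrm{QEC}(G)\le 0$). Given connected graphs $G_j=(V_j,E_j)$ with distinguished vertices $o_j\in V_j$, $1\le j\le r$, the star product $G_1\star\dots\star G_r$ is the graph obtained from the disjoint union of the $G_j$ by identifying all the vertices $o_1,\dots,o_r$ to a single vertex. *)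

theory Defs
  imports "HOL-Analysis.Analysis" "Graph_Theory.Digraph_Component"
begin

text \<open>
  An undirected simple graph, finite or infinite, is a symmetric loop-free digraph given by its
  vertex set and its set of ordered pairs of adjacent vertices (locale
  \<^locale>\<open>pair_bidirected_digraph\<close>). No finiteness is built into this locale. The name
  \<open>connected\<close> has to be qualified because it also denotes topological connectedness.
\<close>

definition connected_graph :: "'a pair_pre_digraph \<Rightarrow> bool" where
  "connected_graph G \<longleftrightarrow>
     pair_bidirected_digraph G \<and> Digraph_Component.connected (with_proj G)"

definition graph_dist :: "'a pair_pre_digraph \<Rightarrow> 'a \<Rightarrow> 'a \<Rightarrow> nat" where
  "graph_dist G x y =
     (LEAST n. \<exists>p. pre_digraph.apath (with_proj G) x p y \<and> length p = n)"

text \<open>Real functions on \<open>V\<close> are represented by functions vanishing outside \<open>V\<close>.\<close>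

definition C0 :: "'a set \<Rightarrow> ('a \<Rightarrow> real) set" where
  "C0 V = {f. finite {x. f x \<noteq> 0} \<and> {x. f x \<noteq> 0} \<subseteq> V}"

text \<open>
  An unordered infinite sum is used since \<open>sum\<close> over an infinite set is \<open>0\<close> by convention. All
  sums below have only finitely many nonzero terms when one factor lies in \<open>C0 V\<close>.
\<close>

definition pairing :: "'a set \<Rightarrow> ('a \<Rightarrow> real) \<Rightarrow> ('a \<Rightarrow> real) \<Rightarrow> real" where
  "pairing V f g = (\<Sum>\<^sub>\<infinity>x\<in>V. f x * g x)"

definition dist_matrix_apply :: "'a pair_pre_digraph \<Rightarrow> ('a \<Rightarrow> real) \<Rightarrow> 'a \<Rightarrow> real" where
  "dist_matrix_apply G f x = (\<Sum>\<^sub>\<infinity>y\<in>pverts G. real (graph_dist G x y) * f y)"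

text \<open>
  The supremum is taken in the extended reals: for an infinite graph it may be \<open>\<infinity>\<close>, and for a
  one-vertex graph it is the supremum \<open>-\<infinity>\<close> of the empty set.
\<close>

definition QEC :: "'a pair_pre_digraph \<Rightarrow> ereal" where
  "QEC G = (SUP f \<in> {f \<in> C0 (pverts G). pairing (pverts G) f f = 1 \<and>
                                         pairing (pverts G) (\<lambda>_. 1) f = 0}.
              ereal (pairing (pverts G) f (dist_matrix_apply G f)))"

text \<open>
  HOL cannot quantify over types inside a formula, so the Hilbert space into which the vertices
  are mapped is a type parameter. A type variable here, in a hypothesis, is universally
  quantified at the level of the theorem, which amounts to ``for some Hilbert space''. Using one
  type for several graphs is no restriction: their Hilbert spaces embed isometrically in the
  Hilbert direct sum.
\<close>

definition QE_class :: "'h::{real_inner, complete_space} itself \<Rightarrow> 'a pair_pre_digraph \<Rightarrow> bool" where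
  "QE_class _ G \<longleftrightarrow> (\<exists>\<phi> :: 'a \<Rightarrow> 'h. \<forall>x\<in>pverts G. \<forall>y\<in>pverts G.
     (norm (\<phi> x - \<phi> y))\<^sup>2 = real (graph_dist G x y))"

text \<open>
  The quotient of the disjoint union of the vertex sets that identifies all base points \<open>b j\<close>:
  the common vertex is \<^const>\<open>None\<close>, and any other vertex \<open>x\<close> of the \<open>j\<close>-th graph is
  \<open>Some (j, x)\<close>.
\<close>

definition star_inj :: "('i \<Rightarrow> 'a) \<Rightarrow> 'i \<Rightarrow> 'a \<Rightarrow> ('i \<times> 'a) option" where
  "star_inj b j x = (if x = b j then None else Some (j, x))"

definition star_product ::
  "'i set \<Rightarrow> ('i \<Rightarrow> 'a pair_pre_digraph) \<Rightarrow> ('i \<Rightarrow> 'a) \<Rightarrow> ('i \<times> 'a) option pair_pre_digraph" where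
  "star_product I G b =
     \<lparr> pverts = (\<Union>j\<in>I. star_inj b j ` pverts (G j)),
       parcs = (\<Union>j\<in>I. map_prod (star_inj b j) (star_inj b j) ` parcs (G j)) \<rparr>"

end

theory Submission
  imports Defs
begin

text \<open>
  Let \<open>\<pi>\<^sub>j\<close> be the retraction of the star product onto its \<open>j\<close>-th branch that collapses all other
  branches to the base point \<open>b j\<close>. A shortest path between two different branches passes through
  the common vertex, so that \<open>d(x, y) = (\<Sum>j. d\<^sub>j(\<pi>\<^sub>j x, \<pi>\<^sub>j y))\<close>
  (\<open>graph_dist_star_product\<close>). Hence, if \<open>g\<^sub>j\<close> is the pushforward of \<open>f\<close> along \<open>\<pi>\<^sub>j\<close>, the quadratic
  form of the star product splits as \<open>\<langle>f, D f\<rangle> = (\<Sum>j. \<langle>g\<^sub>j, D\<^sub>j g\<^sub>j\<rangle>)\<close>. A pushforward preserves the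
  total mass, so each \<open>g\<^sub>j\<close> has sum \<open>0\<close> when \<open>f\<close> has, and the \<open>j\<close>-th summand is at most
  \<open>Q\<^sub>j \<parallel>g\<^sub>j\<parallel>\<^sup>2\<close>.

  On branch \<open>j\<close> without its base point write \<open>N\<^sub>j\<close> for the sum of the squares of \<open>f\<close> and \<open>S\<^sub>j\<close> for the
  sum of \<open>f\<close>. As \<open>f\<close> and \<open>g\<^sub>j\<close> have sum \<open>0\<close>, their values at the base points are \<open>- (\<Sum>j. S\<^sub>j)\<close> and
  \<open>- S\<^sub>j\<close>, so that \<open>\<parallel>g\<^sub>j\<parallel>\<^sup>2 = N\<^sub>j + S\<^sub>j\<^sup>2\<close> and \<open>\<parallel>f\<parallel>\<^sup>2 = (\<Sum>j. N\<^sub>j) + (\<Sum>j. S\<^sub>j)\<^sup>2\<close>. It remains to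
  compare \<open>\<Sum>j. Q\<^sub>j (N\<^sub>j + S\<^sub>j\<^sup>2)\<close> with \<open>\<parallel>f\<parallel>\<^sup>2\<close>, and the Cauchy-Schwarz inequality does this with
  the stated constant (\<open>harmonic_weight_inequality\<close>).
\<close>

section \<open>Graph distance\<close>

text \<open>
  Shortcutting the cycles of a walk does not lengthen it. Thus \<^const>\<open>graph_dist\<close>, a minimum over
  paths, is also the minimum over walks, and walks of length \<open>n\<close> are captured by relational powers,
  which compose more easily than lists of arcs.
\<close>

lemma (in wf_digraph) length_awalk_to_apath_le:
  assumes "awalk u p v"
  shows "length (awalk_to_apath p) \<le> length p"
  using assms
proof (induct rule: awalk_to_apath_induct)
  case (path p)
  then show ?case by (auto simp: awalk_to_apath.simps)
next
  case (decomp p q r s)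
  have "p = q @ r @ s"
    using awalk_cyc_decomp_has_prop[OF decomp(1,3)] decomp(2) by auto
  then show ?case using step_awalk_to_apath[OF decomp(1,2,3)] decomp(4) by simp
qed

lemma (in pair_wf_digraph) relpow_parcs_iff_awalk:
  "u \<in> pverts G \<Longrightarrow> (u, v) \<in> parcs G ^^ n \<longleftrightarrow> (\<exists>p. awalk u p v \<and> length p = n)"
proof (induct n arbitrary: u)
  case 0
  then show ?case by (auto simp: awalk_def)
next
  case (Suc n)
  show ?case
  proof
    assume "(u, v) \<in> parcs G ^^ Suc n"
    then obtain w where w: "(u, w) \<in> parcs G" "(w, v) \<in> parcs G ^^ n"
      by (blast elim: relpow_Suc_E2)
    then obtain p where "awalk w p v" "length p = n"
      using Suc.hyps in_arcsD2 by blast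
    then show "\<exists>p. awalk u p v \<and> length p = Suc n"
      using w Suc.prems by (intro exI[of _ "(u, w) # p"]) (auto simp: awalk_def)
  next
    assume "\<exists>p. awalk u p v \<and> length p = Suc n"
    then obtain w p where "(u, w) \<in> parcs G" "awalk w p v" "length p = n"
      by (auto simp: length_Suc_conv awalk_def in_arcsD2)
    then have "(u, w) \<in> parcs G" "(w, v) \<in> parcs G ^^ n"
      using Suc.hyps in_arcsD2 by blast+
    then show "(u, v) \<in> parcs G ^^ Suc n" by (rule relpow_Suc_I2)
  qed
qed

lemma (in pair_wf_digraph) graph_dist_le_if_relpow:
  assumes "u \<in> pverts G" "(u, v) \<in> parcs G ^^ n"
  shows "graph_dist G u v \<le> n"
proof -
  obtain p where p: "awalk u p v" "length p = n"
    using assms relpow_parcs_iff_awalk by blast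
  have "graph_dist G u v \<le> length (awalk_to_apath p)"
    unfolding graph_dist_def using apath_awalk_to_apath[OF p(1)] by (intro Least_le) blast
  with length_awalk_to_apath_le[OF p(1)] p(2) show ?thesis by simp
qed

lemma (in pair_wf_digraph) relpow_graph_dist:
  assumes "u \<in> pverts G" "(u, v) \<in> parcs G ^^ n"
  shows "(u, v) \<in> parcs G ^^ graph_dist G u v"
proof -
  obtain p where "awalk u p v"
    using assms relpow_parcs_iff_awalk by blast
  then have "\<exists>n p. apath u p v \<and> length p = n"
    using apath_awalk_to_apath by blast
  then have "\<exists>p. apath u p v \<and> length p = graph_dist G u v"
    unfolding graph_dist_def by (rule LeastI_ex)
  then show ?thesis
    using assms(1) relpow_parcs_iff_awalk by (auto simp: apath_def)
qed

lemma (in pair_wf_digraph) graph_dist_self [simp]: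
  "u \<in> pverts G \<Longrightarrow> graph_dist G u u = 0"
  using graph_dist_le_if_relpow[of u u 0] by simp

lemma connected_graph_wf: "connected_graph G \<Longrightarrow> pair_wf_digraph G"
  unfolding connected_graph_def pair_bidirected_digraph_def pair_sym_digraph_def by blast

lemma connected_graph_relpow_dist:
  assumes "connected_graph G" "u \<in> pverts G" "v \<in> pverts G"
  shows "(u, v) \<in> parcs G ^^ graph_dist G u v"
proof -
  interpret pair_bidirected_digraph G
    using assms(1) by (simp add: connected_graph_def)
  have "strongly_connected (with_proj G)"
    using assms(1) pair_sym_arcs
    by (intro symmetric_connected_imp_strongly_connected) (auto simp: connected_graph_def)
  then have "reachable (with_proj G) u v"
    using assms(2,3) by (simp add: strongly_connected_def)
  then have "(u, v) \<in> (parcs G)\<^sup>*"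
    using reachable_rtranclI by fastforce
  then show ?thesis
    using relpow_graph_dist[OF assms(2)] rtrancl_imp_relpow by metis
qed

lemma graph_dist_triangle:
  assumes "connected_graph G" "u \<in> pverts G" "v \<in> pverts G" "w \<in> pverts G"
  shows "graph_dist G u w \<le> graph_dist G u v + graph_dist G v w"
proof -
  interpret pair_wf_digraph G using assms(1) by (rule connected_graph_wf)
  show ?thesis
    using connected_graph_relpow_dist[OF assms(1)] assms
    by (intro graph_dist_le_if_relpow) (auto simp: relpow_add)
qed

section \<open>The distance of the star product\<close>

text \<open>
  The retraction \<open>\<pi>\<^sub>k\<close> onto branch \<open>k\<close>; the common vertex lies in every branch, as its base point.
\<close>
definition star_proj :: "('i \<Rightarrow> 'a) \<Rightarrow> 'i \<Rightarrow> ('i \<times> 'a) option \<Rightarrow> 'a" where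
  "star_proj b k z =
     (case z of None \<Rightarrow> b k | Some (i, x) \<Rightarrow> if i = k then x else b k)"

lemma star_proj_star_inj [simp]:
  "star_proj b k (star_inj b j x) = (if k = j then x else b k)"
  by (auto simp: star_proj_def star_inj_def)

lemma star_proj_None [simp]: "star_proj b k None = b k"
  by (simp add: star_proj_def)

lemma relpow_star_inj:
  assumes "j \<in> I" "(u, v) \<in> parcs (G j) ^^ n"
  shows "(star_inj b j u, star_inj b j v) \<in> parcs (star_product I G b) ^^ n"
  using assms(2)
proof (induct n arbitrary: v)
  case (Suc n)
  then obtain w where w: "(u, w) \<in> parcs (G j) ^^ n" "(w, v) \<in> parcs (G j)"
    by auto
  have "(star_inj b j w, star_inj b j v) \<in> parcs (star_product I G b)"
    using w(2) assms(1) by (force simp: star_product_def)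
  with Suc.hyps[OF w(1)] show ?case by auto
qed simp

text \<open>
  For \<open>\<le>\<close>, shortest paths in the branches, joined at the common vertex if \<open>x\<close> and \<open>y\<close> lie in
  different branches, form a walk whose length is the right-hand side. For \<open>\<ge>\<close>, an arc of the star
  product moves only one of the projections, and along an arc of that branch; by the triangle
  inequality the right-hand side therefore grows by at most one per step of any walk from \<open>x\<close>.
\<close>
lemma graph_dist_star_product:
  assumes fin: "finite I"
    and conn: "\<And>j. j \<in> I \<Longrightarrow> connected_graph (G j)"
    and base: "\<And>j. j \<in> I \<Longrightarrow> b j \<in> pverts (G j)"
    and x: "x \<in> pverts (star_product I G b)" and y: "y \<in> pverts (star_product I G b)"
  shows "graph_dist (star_product I G b) x y =
    (\<Sum>k\<in>I. graph_dist (G k) (star_proj b k x) (star_proj b k y))"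
proof -
  let ?S = "star_product I G b"
  let ?d = "\<lambda>x y. \<Sum>k\<in>I. graph_dist (G k) (star_proj b k x) (star_proj b k y)"
  have wf: "pair_wf_digraph (G j)" if "j \<in> I" for j
    using conn[OF that] by (rule connected_graph_wf)
  interpret pair_wf_digraph ?S
    by unfold_locales
      (force simp: star_product_def dest: pair_wf_digraph.arc_fst_in_verts[OF wf]
        pair_wf_digraph.arc_snd_in_verts[OF wf])+
  have self: "graph_dist (G k) (b k) (b k) = 0" if "k \<in> I" for k
    using pair_wf_digraph.graph_dist_self[OF wf base] that by blast
  have proj: "star_proj b k z \<in> pverts (G k)" if "z \<in> pverts ?S" "k \<in> I" for z k
    using that base by (auto simp: star_product_def)
  obtain i u where i: "i \<in> I" "u \<in> pverts (G i)" "x = star_inj b i u"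
    using x by (auto simp: star_product_def)
  obtain j v where j: "j \<in> I" "v \<in> pverts (G j)" "y = star_inj b j v"
    using y by (auto simp: star_product_def)
  have walk: "(x, y) \<in> parcs ?S ^^ ?d x y"
  proof (cases "i = j")
    case True
    have "?d x y = (\<Sum>k\<in>I. if k = i then graph_dist (G i) u v else 0)"
      using i j True self by (intro sum.cong) auto
    then have "?d x y = graph_dist (G i) u v"
      using fin i by simp
    then show ?thesis
      using relpow_star_inj[where G = G and b = b, OF i(1)
          connected_graph_relpow_dist[OF conn[OF i(1)] i(2) j(2)[folded True]]] i(3) j(3) True
      by simp
  next
    case False
    have "?d x y = (\<Sum>k\<in>I. (if k = i then graph_dist (G i) u (b i) else 0) +
        (if k = j then graph_dist (G j) (b j) v else 0))"
      using i j False self by (intro sum.cong) auto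
    then have d: "?d x y = graph_dist (G i) u (b i) + graph_dist (G j) (b j) v"
      using fin i j by (simp add: sum.distrib)
    have "(x, None) \<in> parcs ?S ^^ graph_dist (G i) u (b i)"
      using relpow_star_inj[where G = G and b = b and u = u and v = "b i", OF i(1)
          connected_graph_relpow_dist[OF conn[OF i(1)] i(2) base[OF i(1)]]] i(3)
      by (simp add: star_inj_def)
    moreover have "(None, y) \<in> parcs ?S ^^ graph_dist (G j) (b j) v"
      using relpow_star_inj[where G = G and b = b and u = "b j" and v = v, OF j(1)
          connected_graph_relpow_dist[OF conn[OF j(1)] base[OF j(1)] j(2)]] j(3)
      by (simp add: star_inj_def)
    ultimately show ?thesis by (auto simp: d relpow_add)
  qed
  have arc: "?d z w \<le> 1" if zw: "(z, w) \<in> parcs ?S" for z w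
  proof -
    obtain k p q where k: "k \<in> I" "(p, q) \<in> parcs (G k)" "z = star_inj b k p" "w = star_inj b k q"
      using zw by (auto simp: star_product_def)
    have "?d z w = (\<Sum>l\<in>I. if l = k then graph_dist (G k) p q else 0)"
      using k self by (intro sum.cong) auto
    also have "\<dots> = graph_dist (G k) p q"
      using fin k by simp
    also have "\<dots> \<le> 1"
      using pair_wf_digraph.graph_dist_le_if_relpow[OF wf[OF k(1)], of p q 1] k
        pair_wf_digraph.in_arcsD1[OF wf[OF k(1)]] by auto
    finally show ?thesis .
  qed
  have lower: "z \<in> pverts ?S \<and> ?d x z \<le> n" if "(x, z) \<in> parcs ?S ^^ n" for z n
    using that
  proof (induct n arbitrary: z)
    case 0
    then show ?case using x proj pair_wf_digraph.graph_dist_self[OF wf] by simp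
  next
    case (Suc n)
    then obtain w where w: "(x, w) \<in> parcs ?S ^^ n" "(w, z) \<in> parcs ?S" by auto
    then have IH: "w \<in> pverts ?S" "?d x w \<le> n" and z: "z \<in> pverts ?S"
      using Suc.hyps in_arcsD2 by blast+
    have "?d x z \<le> ?d x w + ?d w z"
      unfolding sum.distrib[symmetric]
      using graph_dist_triangle[OF conn] proj x IH(1) z by (intro sum_mono) auto
    then show ?case using IH(2) arc[OF w(2)] z by simp
  qed
  show ?thesis
    using graph_dist_le_if_relpow[OF x walk] lower[OF relpow_graph_dist[OF x walk]] by simp
qed

section \<open>Quadratic forms on finitely supported functions\<close>

lemma pairing_eq_sum:
  assumes "finite S" "S \<subseteq> V" "\<And>x. x \<in> V - S \<Longrightarrow> f x * g x = 0"
  shows "pairing V f g = (\<Sum>x\<in>S. f x * g x)"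
proof -
  have "pairing V f g = infsum (\<lambda>x. f x * g x) S"
    unfolding pairing_def using assms by (intro infsum_cong_neutral) auto
  with assms(1) show ?thesis by simp
qed

lemma pairing_dist_eq_sum:
  assumes "finite S" "S \<subseteq> pverts G" "\<And>x. x \<notin> S \<Longrightarrow> f x = 0"
  shows "pairing (pverts G) f (dist_matrix_apply G f) =
    (\<Sum>x\<in>S. \<Sum>y\<in>S. f x * f y * real (graph_dist G x y))"
proof -
  have "dist_matrix_apply G f x = (\<Sum>y\<in>S. real (graph_dist G x y) * f y)" for x
    using pairing_eq_sum[OF assms(1,2), of "\<lambda>y. real (graph_dist G x y)" f] assms(3)
    by (simp add: dist_matrix_apply_def pairing_def)
  then show ?thesis
    using assms by (subst pairing_eq_sum[of S]) (auto simp: sum_distrib_left mult_ac)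
qed

text \<open>
  The homogeneous form of the definition of the QE constant: normalise \<open>g\<close>, unless it is zero on
  \<open>S\<close>.
\<close>
lemma dist_form_le_QEC:
  assumes Q: "QEC G = ereal Q"
    and S: "finite S" "S \<subseteq> pverts G" and sum0: "(\<Sum>x\<in>S. g x) = 0"
  shows "(\<Sum>x\<in>S. \<Sum>y\<in>S. g x * g y * real (graph_dist G x y)) \<le> Q * (\<Sum>x\<in>S. (g x)\<^sup>2)"
proof (cases "(\<Sum>x\<in>S. (g x)\<^sup>2) = 0")
  case True
  then have "\<forall>x\<in>S. g x = 0"
    using S(1) by (simp add: sum_nonneg_eq_0_iff)
  then show ?thesis by simp
next
  case False
  define N where "N = (\<Sum>x\<in>S. (g x)\<^sup>2)"
  have N: "N > 0"
    using False sum_nonneg[of S "\<lambda>x. (g x)\<^sup>2"] unfolding N_def by force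
  define f where "f x = (if x \<in> S then g x / sqrt N else 0)" for x
  have f0: "\<And>x. x \<notin> S \<Longrightarrow> f x = 0" by (simp add: f_def)
  have fS: "\<And>x. x \<in> S \<Longrightarrow> f x = g x / sqrt N" by (simp add: f_def)
  have "f \<in> C0 (pverts G)"
    using S by (auto simp: C0_def f_def intro: finite_subset[of _ S])
  moreover have "pairing (pverts G) f f = (\<Sum>x\<in>S. f x * f x)"
    using S f0 by (intro pairing_eq_sum) auto
  then have "pairing (pverts G) f f = (\<Sum>x\<in>S. (g x)\<^sup>2 / N)"
    using N by (simp add: fS power2_eq_square)
  then have "pairing (pverts G) f f = 1"
    using N by (simp add: sum_divide_distrib[symmetric] N_def[symmetric])
  moreover have "pairing (pverts G) (\<lambda>_. 1) f = (\<Sum>x\<in>S. 1 * f x)"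
    using S f0 by (intro pairing_eq_sum) auto
  then have "pairing (pverts G) (\<lambda>_. 1) f = 0"
    using sum0 by (simp add: fS sum_divide_distrib[symmetric])
  ultimately have "ereal (pairing (pverts G) f (dist_matrix_apply G f)) \<le> ereal Q"
    unfolding Q[symmetric] QEC_def by (intro SUP_upper) auto
  then have "pairing (pverts G) f (dist_matrix_apply G f) \<le> Q" by simp
  also have "pairing (pverts G) f (dist_matrix_apply G f) =
      (\<Sum>x\<in>S. \<Sum>y\<in>S. g x * g y * real (graph_dist G x y) / N)"
    using N by (subst pairing_dist_eq_sum[OF S f0]) (simp_all add: fS)
  finally show ?thesis
    using N by (simp add: sum_divide_distrib[symmetric] N_def[symmetric] field_simps)
qed

text \<open>
  The image under \<open>p\<close> of the signed measure with density \<open>f\<close> on \<open>S\<close>.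
\<close>
definition pushforward :: "('z \<Rightarrow> 'a) \<Rightarrow> 'z set \<Rightarrow> ('z \<Rightarrow> real) \<Rightarrow> 'a \<Rightarrow> real" where
  "pushforward p S f u = (\<Sum>x | x \<in> S \<and> p x = u. f x)"

text \<open>
  Change of variables; with \<open>h = 1\<close> it says that pushforwards preserve the total mass.
\<close>
lemma sum_pushforward:
  assumes "finite S"
  shows "(\<Sum>u\<in>p ` S. pushforward p S f u * h u) = (\<Sum>x\<in>S. f x * h (p x))"
  unfolding pushforward_def sum_distrib_right
  by (subst sum.image_gen[OF assms, of _ p]) (auto intro!: sum.cong)

lemma pushforward_form:
  assumes "finite S"
  shows "(\<Sum>u\<in>p ` S. \<Sum>v\<in>p ` S. pushforward p S f u * pushforward p S f v * K u v) =
    (\<Sum>x\<in>S. \<Sum>y\<in>S. f x * f y * K (p x) (p y))"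
  using sum_pushforward[OF assms, of p f]
  by (simp add: mult.assoc sum_distrib_left[symmetric])

section \<open>The bound for the star product\<close>

text \<open>
  With \<open>a = - Q > 0\<close> and \<open>H = (\<Sum>j. 1 / a j)\<close> the constant on the right is \<open>- 1 / H\<close>. The terms in
  \<open>N\<close> are handled by \<open>1 / H \<le> a j\<close>, which holds because \<open>1 / a j\<close> is one of the summands of \<open>H\<close>.
  For those in \<open>S\<close>, Cauchy-Schwarz applied to \<open>S j = (S j * sqrt (a j)) * sqrt (1 / a j)\<close> gives
  \<open>(\<Sum>j. S j)\<^sup>2 \<le> H * (\<Sum>j. a j * (S j)\<^sup>2)\<close>.
\<close>
lemma harmonic_weight_inequality:
  fixes Q S N :: "'i \<Rightarrow> real"
  assumes I: "finite I" "I \<noteq> {}" and neg: "\<And>j. j \<in> I \<Longrightarrow> Q j < 0"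
    and N: "\<And>j. j \<in> I \<Longrightarrow> N j \<ge> 0"
  shows "(\<Sum>j\<in>I. Q j * (N j + (S j)\<^sup>2)) \<le>
    inverse (\<Sum>j\<in>I. 1 / Q j) * ((\<Sum>j\<in>I. N j) + (\<Sum>j\<in>I. S j)\<^sup>2)"
proof -
  define a where "a j = - Q j" for j
  define H where "H = (\<Sum>j\<in>I. 1 / a j)"
  have a: "a j > 0" if "j \<in> I" for j using neg that by (simp add: a_def)
  have H: "H > 0" unfolding H_def using I a by (intro sum_pos) auto
  have "(\<Sum>j\<in>I. 1 / Q j) = - H"
    by (simp add: H_def a_def sum_negf)
  have le: "1 / H \<le> a j" if "j \<in> I" for j
  proof -
    have "1 / a j \<le> H"
      unfolding H_def using I(1) a that by (intro member_le_sum) (auto simp: less_imp_le)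
    then show ?thesis using H a[OF that] by (simp add: field_simps)
  qed
  have "(\<Sum>j\<in>I. S j) = (\<Sum>j\<in>I. (S j * sqrt (a j)) * sqrt (1 / a j))"
    using a by (intro sum.cong) (auto simp: real_sqrt_divide less_imp_neq[symmetric])
  then have "(\<Sum>j\<in>I. S j)\<^sup>2 \<le> (\<Sum>j\<in>I. (S j * sqrt (a j))\<^sup>2) * (\<Sum>j\<in>I. (sqrt (1 / a j))\<^sup>2)"
    using Cauchy_Schwarz_ineq_sum[of "\<lambda>j. S j * sqrt (a j)" "\<lambda>j. sqrt (1 / a j)" I] by simp
  also have "(\<Sum>j\<in>I. (sqrt (1 / a j))\<^sup>2) = H"
    unfolding H_def using a by (intro sum.cong) (auto simp: less_imp_le)
  also have "(\<Sum>j\<in>I. (S j * sqrt (a j))\<^sup>2) = (\<Sum>j\<in>I. a j * (S j)\<^sup>2)"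
    using a by (intro sum.cong) (auto simp: power_mult_distrib less_imp_le)
  finally have "1 / H * (\<Sum>j\<in>I. S j)\<^sup>2 \<le> (\<Sum>j\<in>I. a j * (S j)\<^sup>2)"
    using H by (simp add: field_simps)
  moreover have "1 / H * (\<Sum>j\<in>I. N j) \<le> (\<Sum>j\<in>I. a j * N j)"
    unfolding sum_distrib_left using le N by (intro sum_mono mult_right_mono)
  ultimately show ?thesis
    unfolding \<open>(\<Sum>j\<in>I. 1 / Q j) = - H\<close>
    by (simp add: a_def inverse_eq_divide algebra_simps sum.distrib sum_negf)
qed

text \<open>
  The retraction is injective on branch \<open>j\<close> without its base point, so the pushforward copies \<open>f\<close>
  there. All remaining vertices of \<open>S\<close> go to \<open>b j\<close>, and since \<open>f\<close> has sum \<open>0\<close>, they carry minus the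
  mass of that branch.
\<close>
lemma pushforward_star_proj_norm:
  assumes S: "finite S" "None \<in> S" "S \<subseteq> pverts (star_product I G b)"
    and sum0: "(\<Sum>z\<in>S. f z) = 0"
  shows "(\<Sum>u\<in>star_proj b j ` S. (pushforward (star_proj b j) S f u)\<^sup>2) =
    (\<Sum>z\<in>{z\<in>S. \<exists>x. z = Some (j, x)}. (f z)\<^sup>2) + (\<Sum>z\<in>{z\<in>S. \<exists>x. z = Some (j, x)}. f z)\<^sup>2"
proof -
  let ?p = "star_proj b j" and ?T = "{z\<in>S. \<exists>x. z = Some (j, x)}"
  have ne: "?p z \<noteq> b j" if "z \<in> ?T" for z
    using that S(3) by (auto simp: star_product_def star_inj_def star_proj_def split: if_splits)
  have out: "?p z = b j" if "z \<in> S - ?T" for z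
    using that by (auto simp: star_proj_def split: option.splits)
  have inj: "inj_on ?p ?T"
    by (auto simp: inj_on_def star_proj_def)
  have img: "?p ` S = insert (b j) (?p ` ?T)"
    using S(2) out by (auto simp: image_iff) (metis star_proj_None)
  have "{z. z \<in> S \<and> ?p z = b j} = S - ?T"
    using ne out by blast
  then have g0: "pushforward ?p S f (b j) = - (\<Sum>z\<in>?T. f z)"
    using sum0 S(1) by (simp add: pushforward_def sum_diff)
  have "{w. w \<in> S \<and> ?p w = ?p z} = {z}" if z: "z \<in> ?T" for z
  proof -
    have "w = z" if "w \<in> S" "?p w = ?p z" for w
      using that z ne[OF z] out[of w] inj_onD[OF inj, of w z] by (cases "w \<in> ?T") auto
    then show ?thesis using z by blast
  qed
  then have g: "pushforward ?p S f (?p z) = f z" if "z \<in> ?T" for z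
    using that by (simp add: pushforward_def)
  have "b j \<notin> ?p ` ?T"
    using ne by (metis (no_types, lifting) imageE)
  then have "(\<Sum>u\<in>?p ` S. (pushforward ?p S f u)\<^sup>2) =
      (pushforward ?p S f (b j))\<^sup>2 + (\<Sum>u\<in>?p ` ?T. (pushforward ?p S f u)\<^sup>2)"
    unfolding img using S(1) by (subst sum.insert) auto
  also have "(\<Sum>u\<in>?p ` ?T. (pushforward ?p S f u)\<^sup>2) = (\<Sum>z\<in>?T. (f z)\<^sup>2)"
    using g by (simp add: sum.reindex[OF inj])
  finally show ?thesis by (simp add: g0)
qed

lemma dist_form_star_product_le:
  assumes I: "finite I" "I \<noteq> {}"
    and conn: "\<And>j. j \<in> I \<Longrightarrow> connected_graph (G j)"
    and base: "\<And>j. j \<in> I \<Longrightarrow> b j \<in> pverts (G j)"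
    and Q: "\<And>j. j \<in> I \<Longrightarrow> QEC (G j) = ereal (Q j)" and neg: "\<And>j. j \<in> I \<Longrightarrow> Q j < 0"
    and S: "finite S" "None \<in> S" "S \<subseteq> pverts (star_product I G b)"
    and sum0: "(\<Sum>z\<in>S. f z) = 0"
  shows "(\<Sum>x\<in>S. \<Sum>y\<in>S. f x * f y * real (graph_dist (star_product I G b) x y)) \<le>
    inverse (\<Sum>j\<in>I. 1 / Q j) * (\<Sum>z\<in>S. (f z)\<^sup>2)"
proof -
  let ?p = "star_proj b" and ?g = "\<lambda>j. pushforward (star_proj b j) S f"
  let ?T = "\<lambda>j. {z\<in>S. \<exists>x. z = Some (j, x)}"
  have branch: "(\<Sum>x\<in>S. \<Sum>y\<in>S. f x * f y * real (graph_dist (G j) (?p j x) (?p j y)))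
      \<le> Q j * ((\<Sum>z\<in>?T j. (f z)\<^sup>2) + (\<Sum>z\<in>?T j. f z)\<^sup>2)" if j: "j \<in> I" for j
  proof -
    have sub: "?p j ` S \<subseteq> pverts (G j)"
      using S(3) base j by (fastforce simp: star_product_def)
    have "(\<Sum>u\<in>?p j ` S. ?g j u) = 0"
      using sum_pushforward[OF S(1), of "?p j" f "\<lambda>_. 1"] sum0 by simp
    from dist_form_le_QEC[OF Q[OF j] _ sub this] show ?thesis
      using S(1) by (simp add: pushforward_form pushforward_star_proj_norm[OF S sum0])
  qed
  have split: "(\<Sum>z\<in>S. h z) = h None + (\<Sum>j\<in>I. \<Sum>z\<in>?T j. h z)" for h :: "_ \<Rightarrow> real"
  proof -
    have "S = insert None (\<Union>j\<in>I. ?T j)"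
      using S(2,3) by (force simp: star_product_def star_inj_def split: if_splits)
    then have "sum h S = sum h (insert None (\<Union>j\<in>I. ?T j))" by simp
    also have "\<dots> = h None + sum h (\<Union>j\<in>I. ?T j)"
      using I(1) S(1) by (subst sum.insert) auto
    also have "sum h (\<Union>j\<in>I. ?T j) = (\<Sum>j\<in>I. \<Sum>z\<in>?T j. h z)"
      using I(1) S(1) by (intro sum.UNION_disjoint) auto
    finally show ?thesis .
  qed
  have "f None = - (\<Sum>j\<in>I. \<Sum>z\<in>?T j. f z)"
    using split[of f] sum0 by simp
  then have norm: "(\<Sum>z\<in>S. (f z)\<^sup>2) =
      (\<Sum>j\<in>I. \<Sum>z\<in>?T j. (f z)\<^sup>2) + (\<Sum>j\<in>I. \<Sum>z\<in>?T j. f z)\<^sup>2"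
    using split[of "\<lambda>z. (f z)\<^sup>2"] by simp
  have "(\<Sum>x\<in>S. \<Sum>y\<in>S. f x * f y * real (graph_dist (star_product I G b) x y)) =
      (\<Sum>x\<in>S. \<Sum>y\<in>S. \<Sum>j\<in>I. f x * f y * real (graph_dist (G j) (?p j x) (?p j y)))"
    using graph_dist_star_product[OF I(1) conn base] S(3)
    by (intro sum.cong refl) (auto simp: sum_distrib_left subset_iff)
  also have "\<dots> = (\<Sum>j\<in>I. \<Sum>x\<in>S. \<Sum>y\<in>S. f x * f y * real (graph_dist (G j) (?p j x) (?p j y)))"
    by (subst (2) sum.swap, subst sum.swap) (rule refl)
  also have "\<dots> \<le> (\<Sum>j\<in>I. Q j * ((\<Sum>z\<in>?T j. (f z)\<^sup>2) + (\<Sum>z\<in>?T j. f z)\<^sup>2))"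
    using branch by (rule sum_mono)
  also have "\<dots> \<le> inverse (\<Sum>j\<in>I. 1 / Q j) *
      ((\<Sum>j\<in>I. \<Sum>z\<in>?T j. (f z)\<^sup>2) + (\<Sum>j\<in>I. \<Sum>z\<in>?T j. f z)\<^sup>2)"
    using I neg by (intro harmonic_weight_inequality) (auto intro: sum_nonneg)
  finally show ?thesis by (simp only: norm)
qed

lemma QEC_star_product_le:
  assumes I: "finite I" "I \<noteq> {}"
    and conn: "\<And>j. j \<in> I \<Longrightarrow> connected_graph (G j)"
    and base: "\<And>j. j \<in> I \<Longrightarrow> b j \<in> pverts (G j)"
    and Q: "\<And>j. j \<in> I \<Longrightarrow> QEC (G j) = ereal (Q j)" and neg: "\<And>j. j \<in> I \<Longrightarrow> Q j < 0"
  shows "QEC (star_product I G b) \<le> ereal (inverse (\<Sum>j\<in>I. 1 / Q j))"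
  unfolding QEC_def
proof (rule SUP_least, clarsimp)
  let ?G = "star_product I G b"
  fix f
  assume f: "f \<in> C0 (pverts ?G)" and norm1: "pairing (pverts ?G) f f = 1"
    and sum0: "pairing (pverts ?G) (\<lambda>_. 1) f = 0"
  \<comment> \<open>Each pushforward may have mass at its base point, the image of the common vertex, even where
    \<open>f\<close> vanishes at that vertex; so the latter has to belong to \<open>S\<close>.\<close>
  define S where "S = insert None {z. f z \<noteq> 0}"
  have "None \<in> pverts ?G"
    using I(2) base by (force simp: star_product_def star_inj_def)
  then have S: "finite S" "None \<in> S" "S \<subseteq> pverts ?G"
    using f by (auto simp: S_def C0_def)
  have f0: "\<And>z. z \<notin> S \<Longrightarrow> f z = 0" by (simp add: S_def)
  have "(\<Sum>z\<in>S. f z) = 0"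
    using sum0 pairing_eq_sum[OF S(1,3), of "\<lambda>_. 1" f] f0 by simp
  moreover have "(\<Sum>z\<in>S. (f z)\<^sup>2) = 1"
    using norm1 pairing_eq_sum[OF S(1,3), of f f] f0 by (simp add: power2_eq_square)
  ultimately show "pairing (pverts ?G) f (dist_matrix_apply ?G f) \<le> inverse (\<Sum>j\<in>I. 1 / Q j)"
    using dist_form_star_product_le[OF I conn base Q neg S, of f]
      pairing_dist_eq_sum[OF S(1,3) f0] by simp
qed

theorem corollary4p6:
  fixes r :: nat
    and G :: "nat \<Rightarrow> 'a pair_pre_digraph"
    and b :: "nat \<Rightarrow> 'a"
    and Q :: "nat \<Rightarrow> real"
  assumes "r \<ge> 2"
    and "\<And>j. j \<in> {1..r} \<Longrightarrow> connected_graph (G j)"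
    and "\<And>j. j \<in> {1..r} \<Longrightarrow> infinite (pverts (G j)) \<or> card (pverts (G j)) \<ge> 2"
    and "\<And>j. j \<in> {1..r} \<Longrightarrow> b j \<in> pverts (G j)"
    and "\<And>j. j \<in> {1..r} \<Longrightarrow> QE_class TYPE('h::{real_inner, complete_space}) (G j)"
    and "\<And>j. j \<in> {1..r} \<Longrightarrow> QEC (G j) = ereal (Q j)"
    and "\<And>j. j \<in> {1..r} \<Longrightarrow> Q j < 0"
  shows "QEC (star_product {1..r} G b) \<le> ereal (inverse (\<Sum>j=1..r. 1 / Q j)) \<and>
         inverse (\<Sum>j=1..r. 1 / Q j) < 0"
proof
  have I: "finite {1..r}" "{1..r} \<noteq> {}" using assms(1) by auto
  show "QEC (star_product {1..r} G b) \<le> ereal (inverse (\<Sum>j=1..r. 1 / Q j))"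
    by (rule QEC_star_product_le[OF I assms(2,4,6,7)])
  have "(\<Sum>j=1..r. - (1 / Q j)) > 0"
    using I assms(7) by (intro sum_pos) auto
  then show "inverse (\<Sum>j=1..r. 1 / Q j) < 0"
    by (simp add: sum_negf)
qed

end
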